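(* Let $(X, \mathcal{E})$ be a ballean and let $\kappa$ be an infinite cardinal such that $\sup_{x\in X} |E[x]| < \kappa$ for each $E \in \mathcal{E}$. Then there exist a group $G$ of permutations of $X$ and a group ideal $\mathcal{I}$ on $G$ such that $(X, \mathcal{E})$ is asymorphic to the ballean $(X, G, \mathcal{I})$ and $|A| < \kappa$ for each $A \in \mathcal{I}$.
   Context: A coarse structure on a set $X$ is a nonempty family $\mathcal{E}$ of subsets of $X \times X$ such that: (1) each $E \in \mathcal{E}$ contains the diagonal $\Delta_X = \{(x,x) : x \in X\}$; (2) if $E, E' \in \mathcal{E}$ then $E \circ E' \in \mathcal{E}$ and $E^{-1} \in \mathcal{E}$, where $E \circ E' = \{(x,y) : \exists z\, ((x,z) \in E, (z,y) \in E')\}$ and $E^{-1} = \{(y,x) : (x,y) \in E\}$; (3) if $E \in \mathcal{E}$ and $\Delta_X \subseteq E' \subseteq E$ then $E' \in \mathcal{E}$; (4) for any $x, y \in X$ there exists $E \in \mathcal{E}$ with $(x,y) \in E$. The pair $(X, \mathcal{E})$ is then called a ballean (or coarse space). For $x \in X$ and $E \in \mathcal{E}$, $E[x] = \{y \in X : (x,y) \in E\}$. A subfamily $\mathcal{E}' \subseteq \mathcal{E}$ is a base for $\mathcal{E}$ if for every $E \in \mathcal{E}$ there is $E' \in \mathcal{E}'$ with $E \subseteq E'$. A mapping $f: X \to X'$ between balleans $(X, \mathcal{E})$ and $(X', \mathcal{E}')$ is macro-uniform if for every $E \in \mathcal{E}$ there exists $E' \in \mathcal{E}'$ such that $f(E[x])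 \subseteq E'[f(x)]$ for each $x \in X$. An asymorphism is a bijection $f$ such that $f$ and $f^{-1}$ are macro-uniform; two balleans are asymorphic if there is an asymorphism between them. For a group $G$, a family $\mathcal{I}$ of subsets of $G$ is an ideal if $A \cup B \in \mathcal{I}$ and $A' \in \mathcal{I}$ whenever $A, B \in \mathcal{I}$ and $A' \subseteq A$ (the case $G \in \mathcal{I}$ is allowed). An ideal $\mathcal{I}$ is a group ideal if every finite subset of $G$ belongs to $\mathcal{I}$ and $A, B \in \mathcal{I}$ implies $AB^{-1} \in \mathcal{I}$. If $G$ acts transitively on $X$ by $(g,x) \mapsto gx$ and $\mathcal{I}$ is a group ideal on $G$, then $(X, G, \mathcal{I})$ denotes the ballean on $X$ whose coarse structure has as base the sets $\{(x,y) \in X \times X : y \in Ax\}$, where $A \in \mathcal{I}$ contains the identity of $G$ and $Ax = \{ax : a \in A\}$. A group of permutations of $X$ acts on $X$ in the natural way; speaking of $(X, G, \mathcal{I})$ includes that this action is transitive. *)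

theory Defs
  imports "HOL-Algebra.Group_Action"
begin

unbundle cardinal_syntax

locale ballean =
  fixes X :: "'a set" and \<E> :: "('a \<times> 'a) set set"
  assumes nonempty: "\<E> \<noteq> {}"
    and subset_Times: "E \<in> \<E> \<Longrightarrow> E \<subseteq> X \<times> X"
    and diagonal: "E \<in> \<E> \<Longrightarrow> Id_on X \<subseteq> E"
    and relcomp_closed: "E \<in> \<E> \<Longrightarrow> E' \<in> \<E> \<Longrightarrow> E O E' \<in> \<E>"
    and converse_closed: "E \<in> \<E> \<Longrightarrow> E\<inverse> \<in> \<E>"
    and subset_closed: "E \<in> \<E> \<Longrightarrow> Id_on X \<subseteq> E' \<Longrightarrow> E' \<subseteq> E \<Longrightarrow> E' \<in> \<E>"
    and pairs_covered: "x \<in> X \<Longrightarrow> y \<in> X \<Longrightarrow> \<exists>E\<in>\<E>. (x, y) \<in> E"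

definition coarse_base :: "('a \<times> 'a) set set \<Rightarrow> ('a \<times> 'a) set set \<Rightarrow> bool" where
  "coarse_base \<E> \<B> \<longleftrightarrow> \<B> \<subseteq> \<E> \<and> (\<forall>E\<in>\<E>. \<exists>E'\<in>\<B>. E \<subseteq> E')"

definition macro_uniform ::
  "'a set \<Rightarrow> ('a \<times> 'a) set set \<Rightarrow> 'b set \<Rightarrow> ('b \<times> 'b) set set \<Rightarrow> ('a \<Rightarrow> 'b) \<Rightarrow> bool" where
  "macro_uniform X \<E> X' \<E>' f \<longleftrightarrow>
     f \<in> X \<rightarrow> X' \<and> (\<forall>E\<in>\<E>. \<exists>E'\<in>\<E>'. \<forall>x\<in>X. f ` (E `` {x}) \<subseteq> E' `` {f x})"

definition asymorphism ::
  "'a set \<Rightarrow> ('a \<times> 'a) set set \<Rightarrow> 'b set \<Rightarrow> ('b \<times> 'b) set set \<Rightarrow> ('a \<Rightarrow> 'b) \<Rightarrow> bool" where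
  "asymorphism X \<E> X' \<E>' f \<longleftrightarrow>
     bij_betw f X X' \<and> macro_uniform X \<E> X' \<E>' f \<and> macro_uniform X' \<E>' X \<E> (inv_into X f)"

definition asymorphic ::
  "'a set \<Rightarrow> ('a \<times> 'a) set set \<Rightarrow> 'b set \<Rightarrow> ('b \<times> 'b) set set \<Rightarrow> bool" where
  "asymorphic X \<E> X' \<E>' \<longleftrightarrow> (\<exists>f. asymorphism X \<E> X' \<E>' f)"

text \<open>The improper ideal (the one containing the whole group) is allowed.\<close>

definition subset_ideal :: "('g, 'm) monoid_scheme \<Rightarrow> 'g set set \<Rightarrow> bool" where
  "subset_ideal G \<I> \<longleftrightarrow> \<I> \<subseteq> Pow (carrier G) \<and>
     (\<forall>A\<in>\<I>. \<forall>B\<in>\<I>. A \<union> B \<in> \<I>) \<and> (\<forall>A\<in>\<I>. \<forall>A'\<subseteq>A. A' \<in> \<I>)"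

definition group_ideal :: "('g, 'm) monoid_scheme \<Rightarrow> 'g set set \<Rightarrow> bool" where
  "group_ideal G \<I> \<longleftrightarrow> subset_ideal G \<I> \<and>
     (\<forall>F. finite F \<and> F \<subseteq> carrier G \<longrightarrow> F \<in> \<I>) \<and>
     (\<forall>A\<in>\<I>. \<forall>B\<in>\<I>. A <#>\<^bsub>G\<^esub> (set_inv\<^bsub>G\<^esub> B) \<in> \<I>)"

text \<open>For an action \<open>\<phi>\<close> of \<open>G\<close> on \<open>X\<close>, the sets \<open>{(x, y) \<in> X \<times> X. y \<in> A x}\<close> with
  \<open>\<one> \<in> A \<in> \<I>\<close>, and the coarse structure of which they form a base; it is well defined by
  \<open>action_coarse_structure\<close> and \<open>coarse_base_unique\<close> below.\<close>

definition action_base ::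
  "('g, 'm) monoid_scheme \<Rightarrow> 'a set \<Rightarrow> ('g \<Rightarrow> 'a \<Rightarrow> 'a) \<Rightarrow> 'g set set \<Rightarrow> ('a \<times> 'a) set set" where
  "action_base G X \<phi> \<I> =
     {{(x, y). x \<in> X \<and> y \<in> X \<and> y \<in> (\<lambda>a. \<phi> a x) ` A} | A. A \<in> \<I> \<and> \<one>\<^bsub>G\<^esub> \<in> A}"

definition action_coarse ::
  "('g, 'm) monoid_scheme \<Rightarrow> 'a set \<Rightarrow> ('g \<Rightarrow> 'a \<Rightarrow> 'a) \<Rightarrow> 'g set set \<Rightarrow> ('a \<times> 'a) set set" where
  "action_coarse G X \<phi> \<I> = (THE \<E>. ballean X \<E> \<and> coarse_base \<E> (action_base G X \<phi> \<I>))"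

text \<open>The supremum of the cardinals \<open>|F i|\<close>, \<open>i \<in> I\<close>, is determined up to \<open>=o\<close>.  It is at most
  the cardinality of the type \<open>'a\<close>, hence it has a representative of type \<open>'a rel\<close>, and it is
  enough to compare it with upper bounds of that type.\<close>

definition is_card_Sup :: "'i set \<Rightarrow> ('i \<Rightarrow> 'a set) \<Rightarrow> 'a rel \<Rightarrow> bool" where
  "is_card_Sup I F r \<longleftrightarrow> Card_order r \<and> (\<forall>i\<in>I. |F i| \<le>o r) \<and>
     (\<forall>s :: 'a rel. Card_order s \<and> (\<forall>i\<in>I. |F i| \<le>o s) \<longrightarrow> r \<le>o s)"

definition card_Sup :: "'i set \<Rightarrow> ('i \<Rightarrow> 'a set) \<Rightarrow> 'a rel" where
  "card_Sup I F = (SOME r. is_card_Sup I F r)"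

lemma is_card_Sup_card_Sup:
  fixes F :: "'i \<Rightarrow> 'a set"
  shows "is_card_Sup I F (card_Sup I F)"
proof -
  let ?U = "{s :: 'a rel. Card_order s \<and> (\<forall>i\<in>I. |F i| \<le>o s)}"
  have "|F i| \<le>o |UNIV :: 'a set|" for i
    by (rule card_of_mono1[OF subset_UNIV])
  then have "|UNIV :: 'a set| \<in> ?U"
    using card_of_Card_order[of "UNIV :: 'a set"] by blast
  then obtain r where r: "r \<in> ?U" "\<And>s. (s, r) \<in> ordLess \<Longrightarrow> s \<notin> ?U"
    by (rule wfE_min[OF wf_ordLess, of _ ?U]) blast+
  have "r \<le>o s" if "s \<in> ?U" for s
    using r that not_ordLess_iff_ordLeq[of r s] by (auto simp: card_order_on_well_order_on)
  with r(1) have "is_card_Sup I F r"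
    by (auto simp: is_card_Sup_def)
  then show ?thesis
    unfolding card_Sup_def by (rule someI)
qed

lemma coarse_base_unique:
  assumes "ballean X \<E>" "coarse_base \<E> \<B>" "ballean X \<E>'" "coarse_base \<E>' \<B>"
  shows "\<E> = \<E>'"
proof -
  have "\<E>1 \<subseteq> \<E>2"
    if hyps: "ballean X \<E>1" "coarse_base \<E>1 \<B>" "ballean X \<E>2" "coarse_base \<E>2 \<B>" for \<E>1 \<E>2
  proof
    fix E assume E: "E \<in> \<E>1"
    then obtain B where "B \<in> \<B>" "E \<subseteq> B" using hyps(2) by (auto simp: coarse_base_def)
    moreover have "Id_on X \<subseteq> E" using ballean.diagonal[OF hyps(1) E] .
    ultimately show "E \<in> \<E>2"
      using ballean.subset_closed[OF hyps(3)] hyps(4) unfolding coarse_base_def by blast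
  qed
  from this[OF assms] this[OF assms(3,4,1,2)] show ?thesis by blast
qed

lemma action_coarse_structure:
  assumes "transitive_action G X \<phi>" "group_ideal G \<I>"
  shows "ballean X (action_coarse G X \<phi> \<I>)"
    and "coarse_base (action_coarse G X \<phi> \<I>) (action_base G X \<phi> \<I>)"
proof -
  interpret transitive_action G X \<phi> by fact
  interpret group_hom G "BijGroup X" \<phi> by (rule group_hom)
  note I = assms(2)[unfolded group_ideal_def subset_ideal_def]
  have "\<I> \<subseteq> Pow (carrier G)" using I by (elim conjE)
  then have IC: "A \<subseteq> carrier G" if "A \<in> \<I>" for A using that by blast
  have "\<forall>F. finite F \<and> F \<subseteq> carrier G \<longrightarrow> F \<in> \<I>" using I by (elim conjE)
  then have fin: "F \<in> \<I>" if "finite F" "F \<subseteq> carrier G" for F using that by simp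
  have "\<forall>A\<in>\<I>. \<forall>B\<in>\<I>. A <#>\<^bsub>G\<^esub> (set_inv\<^bsub>G\<^esub> B) \<in> \<I>" using I by (elim conjE)
  then have mult_invI: "A <#>\<^bsub>G\<^esub> (set_inv\<^bsub>G\<^esub> B) \<in> \<I>" if "A \<in> \<I>" "B \<in> \<I>" for A B
    using that by simp
  have invI: "set_inv\<^bsub>G\<^esub> A \<in> \<I>" if "A \<in> \<I>" for A
  proof -
    have "{\<one>\<^bsub>G\<^esub>} <#>\<^bsub>G\<^esub> (set_inv\<^bsub>G\<^esub> A) \<in> \<I>"
      using mult_invI that fin[of "{\<one>\<^bsub>G\<^esub>}"] by simp
    moreover have "{\<one>\<^bsub>G\<^esub>} <#>\<^bsub>G\<^esub> (set_inv\<^bsub>G\<^esub> A) = set_inv\<^bsub>G\<^esub> A"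
      using IC[OF that] by (auto simp: set_mult_def SET_INV_def subset_iff)
    ultimately show ?thesis by simp
  qed
  have multI: "A <#>\<^bsub>G\<^esub> B \<in> \<I>" if "A \<in> \<I>" "B \<in> \<I>" for A B
  proof -
    have "set_inv\<^bsub>G\<^esub> (set_inv\<^bsub>G\<^esub> B) = B"
      using IC[OF that(2)] by (auto simp: SET_INV_def subset_iff)
    then show ?thesis using mult_invI[OF that(1) invI[OF that(2)]] by simp
  qed
  define R where "R A = {(x, y). x \<in> X \<and> y \<in> X \<and> y \<in> (\<lambda>a. \<phi> a x) ` A}" for A
  have base: "action_base G X \<phi> \<I> = {R A | A. A \<in> \<I> \<and> \<one>\<^bsub>G\<^esub> \<in> A}"
    by (simp add: action_base_def R_def)
  have one_act: "\<phi> \<one>\<^bsub>G\<^esub> x = x" if "x \<in> X" for x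
    using that id_eq_one restrict_apply'[OF that, of "\<lambda>x. x"] by simp
  have R_diag: "Id_on X \<subseteq> R A" if "\<one>\<^bsub>G\<^esub> \<in> A" for A
    using that one_act by (force simp: R_def)
  have R_comp: "R A O R B \<subseteq> R (B <#>\<^bsub>G\<^esub> A)" if "A \<in> \<I>" "B \<in> \<I>" for A B
  proof clarify
    fix x z y assume "(x, z) \<in> R A" "(z, y) \<in> R B"
    then obtain a b where "x \<in> X" "y \<in> X" "a \<in> A" "b \<in> B" "y = \<phi> b (\<phi> a x)"
      by (auto simp: R_def)
    moreover then have "y = \<phi> (b \<otimes>\<^bsub>G\<^esub> a) x"
      using composition_rule[of x b a] IC[OF that(1)] IC[OF that(2)]
      by (simp add: subset_iff del: hom_mult)
    moreover from \<open>a \<in> A\<close> \<open>b \<in> B\<close> have "b \<otimes>\<^bsub>G\<^esub> a \<in> B <#>\<^bsub>G\<^esub> A"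
      unfolding set_mult_def by blast
    ultimately show "(x, y) \<in> R (B <#>\<^bsub>G\<^esub> A)"
      unfolding R_def by blast
  qed
  have R_conv: "(R A)\<inverse> \<subseteq> R (set_inv\<^bsub>G\<^esub> A)" if "A \<in> \<I>" for A
  proof clarify
    fix x y assume "(x, y) \<in> R A"
    then obtain a where a: "x \<in> X" "y \<in> X" "a \<in> A" "y = \<phi> a x"
      by (auto simp: R_def)
    then have "\<phi> (inv\<^bsub>G\<^esub> a) y = x"
      using orbit_sym_aux[of a x y] IC[OF that] by auto
    moreover have "inv\<^bsub>G\<^esub> a \<in> set_inv\<^bsub>G\<^esub> A"
      using a unfolding SET_INV_def by blast
    ultimately show "(y, x) \<in> R (set_inv\<^bsub>G\<^esub> A)"
      using a(1,2) unfolding R_def by blast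
  qed
  define \<E> where "\<E> = {E. Id_on X \<subseteq> E \<and> (\<exists>A\<in>\<I>. \<one>\<^bsub>G\<^esub> \<in> A \<and> E \<subseteq> R A)}"
  have b: "ballean X \<E>"
  proof
    have "{\<one>\<^bsub>G\<^esub>} \<in> \<I>" by (rule fin) auto
    then have "R {\<one>\<^bsub>G\<^esub>} \<in> \<E>" using R_diag by (auto simp: \<E>_def)
    then show "\<E> \<noteq> {}" by blast
  next
    fix E assume "E \<in> \<E>"
    then show "E \<subseteq> X \<times> X" "Id_on X \<subseteq> E" by (auto simp: \<E>_def R_def)
  next
    fix E E' assume E: "E \<in> \<E>" and E': "E' \<in> \<E>"
    then obtain A B where A: "A \<in> \<I>" "\<one>\<^bsub>G\<^esub> \<in> A" "E \<subseteq> R A"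
      and B: "B \<in> \<I>" "\<one>\<^bsub>G\<^esub> \<in> B" "E' \<subseteq> R B" by (auto simp: \<E>_def)
    have "E O E' \<subseteq> R (B <#>\<^bsub>G\<^esub> A)"
      using A(3) B(3) R_comp[OF A(1) B(1)] by blast
    moreover have "\<one>\<^bsub>G\<^esub> \<in> B <#>\<^bsub>G\<^esub> A"
      using A(2) B(2) by (force simp: set_mult_def)
    moreover have "Id_on X \<subseteq> E O E'" using E E' unfolding \<E>_def by blast
    ultimately show "E O E' \<in> \<E>" using multI[OF B(1) A(1)] by (auto simp: \<E>_def)
  next
    fix E assume E: "E \<in> \<E>"
    then obtain A where A: "A \<in> \<I>" "\<one>\<^bsub>G\<^esub> \<in> A" "E \<subseteq> R A" by (auto simp: \<E>_def)
    have "E\<inverse> \<subseteq> R (set_inv\<^bsub>G\<^esub> A)" using A(3) R_conv[OF A(1)] by blast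
    moreover have "\<one>\<^bsub>G\<^esub> \<in> set_inv\<^bsub>G\<^esub> A" using A(2) by (force simp: SET_INV_def)
    moreover have "Id_on X \<subseteq> E\<inverse>" using E unfolding \<E>_def by blast
    ultimately show "E\<inverse> \<in> \<E>" using invI[OF A(1)] by (auto simp: \<E>_def)
  next
    fix E E' assume "E \<in> \<E>" "Id_on X \<subseteq> E'" "E' \<subseteq> E"
    then show "E' \<in> \<E>" unfolding \<E>_def by blast
  next
    fix x y assume xy: "x \<in> X" "y \<in> X"
    then obtain g where g: "g \<in> carrier G" "\<phi> g x = y" using unique_orbit by blast
    have "{\<one>\<^bsub>G\<^esub>, g} \<in> \<I>" using g by (intro fin) auto
    then have "R {\<one>\<^bsub>G\<^esub>, g} \<in> \<E>" using R_diag by (auto simp: \<E>_def)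
    moreover have "(x, y) \<in> R {\<one>\<^bsub>G\<^esub>, g}" using xy g by (auto simp: R_def)
    ultimately show "\<exists>E\<in>\<E>. (x, y) \<in> E" by blast
  qed
  have c: "coarse_base \<E> (action_base G X \<phi> \<I>)"
    unfolding coarse_base_def base \<E>_def using R_diag by blast
  have "action_coarse G X \<phi> \<I> = \<E>"
    unfolding action_coarse_def
  proof (rule the_equality)
    show "ballean X \<E> \<and> coarse_base \<E> (action_base G X \<phi> \<I>)" using b c ..
  next
    fix \<E>' assume "ballean X \<E>' \<and> coarse_base \<E>' (action_base G X \<phi> \<I>)"
    then show "\<E>' = \<E>" using coarse_base_unique[OF _ _ b c] by blast
  qed
  with b c show "ballean X (action_coarse G X \<phi> \<I>)"
    and "coarse_base (action_coarse G X \<phi> \<I>) (action_base G X \<phi> \<I>)" by simp_all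
qed

end

theory Submission
  imports Defs
begin

text \<open>Take for \<open>G\<close> all permutations of \<open>X\<close> whose graph lies in some entourage, and for
  the ideal all sets of fewer than \<open>\<kappa>\<close> such permutations with a common entourage.  What has to
  be shown is that every entourage is covered by the graphs of one such set.  For a symmetric
  entourage \<open>E\<close> colour the points of \<open>X\<close> by fewer than \<open>\<kappa>\<close> colours such that distinct points
  related by \<open>E O E\<close> get distinct colours.  Then for each pair of colours \<open>a\<close>, \<open>b\<close> the
  \<open>E\<close>-pairs coloured \<open>a\<close> and \<open>b\<close> form a partial matching, which extends to an involution of
  \<open>X\<close>, and these involutions cover \<open>E\<close>.  The colouring is a greedy one if the degrees are
  uniformly finite; otherwise the connected components are bounded by an infinite cardinal below
  \<open>\<kappa>\<close> and can be coloured injectively.\<close>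

section \<open>Cardinals\<close>

lemma finite_card_of_ordLess_Cinfinite:
  assumes "finite A" "Cinfinite \<kappa>"
  shows "|A| <o \<kappa>"
proof -
  have "|A| <o |Field \<kappa>|"
    using assms finite_ordLess_infinite[OF card_of_Well_order card_of_Well_order, of A "Field \<kappa>"]
    by (simp add: cinfinite_def Field_card_of)
  then show ?thesis
    using card_of_Field_ordIso assms(2) ordLess_ordIso_trans by blast
qed

text \<open>In the infinite case the product embeds into the square of \<open>A <+> B\<close>, which
  has the size of \<open>A <+> B\<close> itself, and a sum of two cardinals below an infinite
  \<open>\<kappa>\<close> stays below it.\<close>

lemma card_of_Times_ordLess_Cinfinite:
  assumes "|A| <o \<kappa>" "|B| <o \<kappa>" "Cinfinite \<kappa>"
  shows "|A \<times> B| <o \<kappa>"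
proof (cases "finite (A \<times> B)")
  case True
  then show ?thesis using finite_card_of_ordLess_Cinfinite assms(3) by blast
next
  case False
  let ?C = "A <+> B"
  have "infinite ?C" using False by auto
  have "|A \<times> B| \<le>o |?C \<times> ?C|"
    by (rule card_of_ordLeqI[of "\<lambda>(a, b). (Inl a, Inr b)"]) (auto simp: inj_on_def)
  also have "|?C \<times> ?C| =o |?C|"
    using \<open>infinite ?C\<close> by (rule card_of_Times_same_infinite)
  finally have "|A \<times> B| \<le>o |?C|" .
  moreover have "|?C| <o \<kappa>"
    using card_of_Plus_ordLess_infinite_Field[of \<kappa> A B] assms by (auto simp: cinfinite_def)
  ultimately show ?thesis by (rule ordLeq_ordLess_trans)
qed

section \<open>Vertex colourings\<close>

text \<open>By Zorn's lemma: two points of the union of a chain lie in a common member, so the union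
  is again independent. A point outside a maximal \<open>S\<close> without a neighbour in
  \<open>S\<close> could be added to it.\<close>

lemma ex_maximal_independent:
  obtains S where "S \<subseteq> Y" "\<And>x y. x \<in> S \<Longrightarrow> y \<in> S \<Longrightarrow> x \<noteq> y \<Longrightarrow> (x, y) \<notin> F"
    "\<And>x. x \<in> Y - S \<Longrightarrow> \<exists>y\<in>S. (x, y) \<in> F \<or> (y, x) \<in> F"
proof -
  let ?I = "{S. S \<subseteq> Y \<and> (\<forall>x\<in>S. \<forall>y\<in>S. x \<noteq> y \<longrightarrow> (x, y) \<notin> F)}"
  have "\<exists>M\<in>?I. \<forall>S\<in>?I. M \<subseteq> S \<longrightarrow> S = M"
  proof (rule subset_Zorn')
    fix C assume "subset.chain ?I C"
    then have sub: "C \<subseteq> ?I" and lin: "\<And>S T. S \<in> C \<Longrightarrow> T \<in> C \<Longrightarrow> S \<subseteq> T \<or> T \<subseteq> S"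
      by (simp_all add: subset_chain_def)
    have "(x, y) \<notin> F" if xy: "x \<in> \<Union>C" "y \<in> \<Union>C" "x \<noteq> y" for x y
    proof -
      obtain S T where ST: "S \<in> C" "T \<in> C" "x \<in> S" "y \<in> T" using xy by blast
      then have "S \<subseteq> T \<or> T \<subseteq> S" "S \<in> ?I" "T \<in> ?I"
        using sub lin[of S T] by blast+
      then show ?thesis using ST xy(3) by blast
    qed
    moreover have "\<Union>C \<subseteq> Y" using sub by blast
    ultimately show "\<Union>C \<in> ?I" by blast
  qed
  then obtain M where M: "M \<in> ?I" "\<forall>S\<in>?I. M \<subseteq> S \<longrightarrow> S = M" by (rule bexE)
  have "\<exists>y\<in>M. (x, y) \<in> F \<or> (y, x) \<in> F" if x: "x \<in> Y - M" for x
  proof (rule ccontr)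
    assume "\<not> ?thesis"
    then have "insert x M \<in> ?I" using M(1) x by auto
    then have "insert x M = M" using bspec[OF M(2), of "insert x M"] by blast
    then show False using x by blast
  qed
  with M(1) show thesis by (intro that[of M]) auto
qed

text \<open>Induction on the number of colours. A maximal independent set gets the last colour; each
  remaining point has a neighbour in that set, so its degree among the remaining points is smaller.
  Colouring a whole independent set at once lets \<open>Y\<close> be infinite.\<close>

lemma finite_degree_colouring:
  assumes "sym F"
    and "\<And>x. x \<in> Y \<Longrightarrow> finite {y \<in> Y. (x, y) \<in> F \<and> x \<noteq> y} \<and> card {y \<in> Y. (x, y) \<in> F \<and> x \<noteq> y} < n"
  shows "\<exists>f. f ` Y \<subseteq> {..<n} \<and> (\<forall>x\<in>Y. \<forall>y\<in>Y. (x, y) \<in> F \<longrightarrow> x \<noteq> y \<longrightarrow> f x \<noteq> f y)"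
  using assms(2)
proof (induction n arbitrary: Y)
  case 0
  \<comment> \<open>No degree is below 0, so there are no points to colour.\<close>
  then have "Y = {}" by blast
  then show ?case by simp
next
  case (Suc n)
  obtain S where S: "S \<subseteq> Y" "\<And>x y. x \<in> S \<Longrightarrow> y \<in> S \<Longrightarrow> x \<noteq> y \<Longrightarrow> (x, y) \<notin> F"
    "\<And>x. x \<in> Y - S \<Longrightarrow> \<exists>y\<in>S. (x, y) \<in> F \<or> (y, x) \<in> F"
    using ex_maximal_independent[of Y F] by blast
  have "finite {y \<in> Y - S. (x, y) \<in> F \<and> x \<noteq> y} \<and> card {y \<in> Y - S. (x, y) \<in> F \<and> x \<noteq> y} < n"
    if x: "x \<in> Y - S" for x
  proof -
    let ?N = "{y \<in> Y. (x, y) \<in> F \<and> x \<noteq> y}" and ?N' = "{y \<in> Y - S. (x, y) \<in> F \<and> x \<noteq> y}"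
    obtain y where "y \<in> S" "(x, y) \<in> F" using S(3)[OF x] assms(1) by (auto dest: symD)
    then have "?N' \<subset> ?N" using S(1) x by blast
    moreover have "finite ?N" "card ?N < Suc n" using Suc.prems x by blast+
    ultimately show ?thesis
      using psubset_card_mono[of ?N ?N'] finite_subset[of ?N' ?N] by auto
  qed
  then have "\<exists>f. f ` (Y - S) \<subseteq> {..<n} \<and>
      (\<forall>x\<in>Y - S. \<forall>y\<in>Y - S. (x, y) \<in> F \<longrightarrow> x \<noteq> y \<longrightarrow> f x \<noteq> f y)"
    by (rule Suc.IH)
  then obtain f where f: "f ` (Y - S) \<subseteq> {..<n}"
    "\<forall>x\<in>Y - S. \<forall>y\<in>Y - S. (x, y) \<in> F \<longrightarrow> x \<noteq> y \<longrightarrow> f x \<noteq> f y"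
    by (elim exE conjE)
  let ?f = "\<lambda>x. if x \<in> S then n else f x"
  have "?f ` Y \<subseteq> {..<Suc n}" using f(1) by (auto simp: image_subset_iff less_Suc_eq)
  moreover have "?f x \<noteq> ?f y" if xy: "x \<in> Y" "y \<in> Y" "(x, y) \<in> F" "x \<noteq> y" for x y
  proof -
    have lt: "f z < n" if "z \<in> Y - S" for z using f(1) that by auto
    have "x \<notin> S \<or> y \<notin> S" using S(2) xy by blast
    then show ?thesis using f(2) lt[of x] lt[of y] xy by (cases "x \<in> S"; cases "y \<in> S"; simp)
  qed
  ultimately show ?case by (intro exI[of _ ?f]) blast
qed

text \<open>The points reachable in exactly \<open>n\<close> steps number at most \<open>r\<close>,
  by induction on \<open>n\<close>. The union over all \<open>n\<close> is countable and keeps the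
  bound because \<open>r\<close> is infinite.\<close>

lemma rtrancl_Image_ordLeq:
  assumes "\<And>x. |F `` {x}| \<le>o r" "Cinfinite r"
  shows "|F\<^sup>* `` {x}| \<le>o r"
proof -
  have inf: "infinite (Field r)" "Card_order r" using assms(2) by (auto simp: cinfinite_def)
  have "|(F ^^ n) `` {x}| \<le>o r" for n
  proof (induction n)
    case 0
    then show ?case
      using finite_card_of_ordLess_Cinfinite[OF _ assms(2), of "{x}"] by (simp add: ordLess_imp_ordLeq)
  next
    case (Suc n)
    have "(F ^^ Suc n) `` {x} = (\<Union>y\<in>(F ^^ n) `` {x}. F `` {y})" by auto
    also have "|\<dots>| \<le>o r"
      using assms(1) by (intro card_of_UNION_ordLeq_infinite_Field[OF inf Suc]) blast
    finally show ?case .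
  qed
  moreover have "|UNIV :: nat set| \<le>o r"
    using infinite_iff_card_of_nat[of "Field r"] inf card_of_Field_ordIso ordLeq_ordIso_trans by blast
  ultimately have "|\<Union>n. (F ^^ n) `` {x}| \<le>o r"
    by (intro card_of_UNION_ordLeq_infinite_Field[OF inf]) auto
  moreover have "F\<^sup>* `` {x} = (\<Union>n. (F ^^ n) `` {x})" by (auto simp: rtrancl_power)
  ultimately show ?thesis by simp
qed

text \<open>Each connected component has size at most \<open>r\<close>, hence injects into
  \<open>Field r\<close>. Colours may repeat across components, since related points share a
  component.\<close>

lemma infinite_degree_colouring:
  assumes "sym F" "\<And>x. |F `` {x}| \<le>o r" "Cinfinite r"
  shows "\<exists>f. range f \<subseteq> Field r \<and> (\<forall>x y. (x, y) \<in> F \<longrightarrow> x \<noteq> y \<longrightarrow> f x \<noteq> f y)"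
proof -
  have "\<exists>g. inj_on g (F\<^sup>* `` {x}) \<and> g ` (F\<^sup>* `` {x}) \<subseteq> Field r" for x
  proof -
    have "|F\<^sup>* `` {x}| \<le>o |Field r|"
      using rtrancl_Image_ordLeq[OF assms(2,3), of x] assms(3) card_of_Field_ordIso
        ordIso_symmetric ordLeq_ordIso_trans by blast
    then show ?thesis by (simp add: card_of_ordLeq[symmetric])
  qed
  then have "\<exists>g. inj_on g C \<and> g ` C \<subseteq> Field r" if "C \<in> range (\<lambda>x. F\<^sup>* `` {x})" for C
    using that by blast
  \<comment> \<open>The injection is chosen per component and not per point, so that two related
    points are coloured by the same injection.\<close>
  then obtain g where
    g: "\<And>C. C \<in> range (\<lambda>x. F\<^sup>* `` {x}) \<Longrightarrow> inj_on (g C) C \<and> g C ` C \<subseteq> Field r"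
    by metis
  let ?f = "\<lambda>x. g (F\<^sup>* `` {x}) x"
  have "range ?f \<subseteq> Field r" using g by blast
  moreover have "?f x \<noteq> ?f y" if xy: "(x, y) \<in> F" "x \<noteq> y" for x y
  proof -
    have "(y, x) \<in> F" using xy assms(1) by (auto dest: symD)
    then have "F\<^sup>* `` {x} = F\<^sup>* `` {y}"
      using xy(1) by (auto intro: converse_rtrancl_into_rtrancl)
    moreover have "y \<in> F\<^sup>* `` {x}" using xy(1) by auto
    ultimately show ?thesis using g[of "F\<^sup>* `` {x}"] xy(2) by (auto dest: inj_onD)
  qed
  ultimately show ?thesis by (intro exI[of _ ?f]) blast
qed

section \<open>Involutions from matchings\<close>

text \<open>The restriction to \<open>X\<close> is there because \<open>Bij X\<close> consists of
  extensional functions. For a symmetric single-valued \<open>M\<close> the map swaps the ends of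
  each edge.\<close>

definition matching_perm :: "'a set \<Rightarrow> ('a \<times> 'a) set \<Rightarrow> 'a \<Rightarrow> 'a" where
  "matching_perm X M = (\<lambda>x\<in>X. if x \<in> Domain M then THE y. (x, y) \<in> M else x)"

lemma matching_perm_eq:
  assumes "single_valued M" "M \<subseteq> X \<times> X" "(x, y) \<in> M"
  shows "matching_perm X M x = y"
proof -
  have "(THE y. (x, y) \<in> M) = y" using assms by (auto dest: single_valuedD)
  then show ?thesis using assms by (auto simp: matching_perm_def)
qed

lemma matching_perm_id: "x \<in> X \<Longrightarrow> x \<notin> Domain M \<Longrightarrow> matching_perm X M x = x"
  by (simp add: matching_perm_def)

text \<open>The map is its own inverse on \<open>X\<close>: symmetry leads back along each edge, and
  the unmatched points are fixed.\<close>

lemma matching_perm_Bij: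
  assumes "sym M" "single_valued M" "M \<subseteq> X \<times> X"
  shows "matching_perm X M \<in> Bij X"
proof -
  have "matching_perm X M x \<in> X \<and> matching_perm X M (matching_perm X M x) = x" if "x \<in> X" for x
  proof (cases "x \<in> Domain M")
    case True
    then obtain y where "(x, y) \<in> M" by blast
    then show ?thesis
      using assms matching_perm_eq[OF assms(2,3), of x y] matching_perm_eq[OF assms(2,3), of y x]
      by (auto dest: symD)
  next
    case False
    then show ?thesis using that by (simp add: matching_perm_id)
  qed
  then have "bij_betw (matching_perm X M) X X"
    by (intro bij_betw_byWitness[where f' = "matching_perm X M"]) auto
  then show ?thesis by (simp add: Bij_def matching_perm_def)
qed

section \<open>Permutations controlled by an entourage\<close>

context ballean
begin

text \<open>One entourage has to serve all of \<open>A\<close>: its members are uniformly close to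
  the identity.\<close>

definition controlled :: "('a \<Rightarrow> 'a) set \<Rightarrow> bool" where
  "controlled A \<longleftrightarrow> A \<subseteq> Bij X \<and> (\<exists>E\<in>\<E>. \<forall>g\<in>A. \<forall>x\<in>X. (x, g x) \<in> E)"

text \<open>Here closeness to the identity is asked of each permutation separately; a common
  entourage enters only through \<open>perm_ideal\<close>.\<close>

definition perm_group :: "('a \<Rightarrow> 'a) monoid" where
  "perm_group = (BijGroup X)\<lparr>carrier := {g. controlled {g}}\<rparr>"

definition perm_ideal :: "'k rel \<Rightarrow> ('a \<Rightarrow> 'a) set set" where
  "perm_ideal \<kappa> = {A. controlled A \<and> |A| <o \<kappa>}"

section \<open>Controlled sets under unions, products and inverses\<close>

lemma controlledI:
  "A \<subseteq> Bij X \<Longrightarrow> E \<in> \<E> \<Longrightarrow> (\<And>g x. g \<in> A \<Longrightarrow> x \<in> X \<Longrightarrow> (x, g x) \<in> E) \<Longrightarrow> controlled A"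
  by (auto simp: controlled_def)

lemma controlledE:
  assumes "controlled A"
  obtains E where "A \<subseteq> Bij X" "E \<in> \<E>" "\<And>g x. g \<in> A \<Longrightarrow> x \<in> X \<Longrightarrow> (x, g x) \<in> E"
  using assms by (auto simp: controlled_def)

text \<open>As both entourages contain the diagonal, each of them lies in the composite
  \<open>E O E'\<close>.\<close>

lemma entourage_Un:
  assumes "E \<in> \<E>" "E' \<in> \<E>"
  shows "E \<union> E' \<in> \<E>"
proof (rule subset_closed[OF relcomp_closed[OF assms]])
  show "Id_on X \<subseteq> E \<union> E'" using diagonal assms by blast
  show "E \<union> E' \<subseteq> E O E'"
    using diagonal[OF assms(1)] diagonal[OF assms(2)] subset_Times[OF assms(1)]
      subset_Times[OF assms(2)] by blast
qed

lemma controlled_subset: "controlled A \<Longrightarrow> A' \<subseteq> A \<Longrightarrow> controlled A'"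
  unfolding controlled_def by blast

lemma controlled_Un:
  assumes "controlled A" "controlled B"
  shows "controlled (A \<union> B)"
proof -
  from assms obtain E E' where "E \<in> \<E>" "E' \<in> \<E>" "A \<subseteq> Bij X" "B \<subseteq> Bij X"
    "\<And>g x. g \<in> A \<Longrightarrow> x \<in> X \<Longrightarrow> (x, g x) \<in> E" "\<And>g x. g \<in> B \<Longrightarrow> x \<in> X \<Longrightarrow> (x, g x) \<in> E'"
    by (meson controlledE)
  then show ?thesis by (intro controlledI[OF _ entourage_Un[of E E']]) auto
qed

lemma controlled_empty: "controlled {}"
  using nonempty by (auto simp: controlled_def)

lemma controlled_finite:
  "finite F \<Longrightarrow> (\<And>g. g \<in> F \<Longrightarrow> controlled {g}) \<Longrightarrow> controlled F"
proof (induction F rule: finite_induct)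
  case empty
  show ?case by (rule controlled_empty)
next
  case (insert g F)
  then show ?case using controlled_Un[of "{g}" F] by simp
qed

lemma controlled_set_mult:
  assumes "controlled A" "controlled B"
  shows "controlled (A <#>\<^bsub>BijGroup X\<^esub> B)"
proof -
  from assms obtain E E' where E: "E \<in> \<E>" "E' \<in> \<E>" "A \<subseteq> Bij X" "B \<subseteq> Bij X"
    "\<And>g x. g \<in> A \<Longrightarrow> x \<in> X \<Longrightarrow> (x, g x) \<in> E" "\<And>g x. g \<in> B \<Longrightarrow> x \<in> X \<Longrightarrow> (x, g x) \<in> E'"
    by (meson controlledE)
  have eq: "A <#>\<^bsub>BijGroup X\<^esub> B = {compose X g h | g h. g \<in> A \<and> h \<in> B}"
    using E(3,4) by (force simp: set_mult_def BijGroup_def)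
  \<comment> \<open>A product applies its right factor first: \<open>h\<close> moves
    \<open>x\<close> along \<open>E'\<close>, then \<open>g\<close> moves \<open>h x\<close> along
    \<open>E\<close>. Hence the order \<open>E' O E\<close>.\<close>
  show ?thesis
  proof (rule controlledI[OF _ relcomp_closed[OF E(2,1)]])
    show "A <#>\<^bsub>BijGroup X\<^esub> B \<subseteq> Bij X"
      using E(3,4) unfolding eq by (auto intro: compose_Bij)
    fix k x assume "k \<in> A <#>\<^bsub>BijGroup X\<^esub> B" and x: "x \<in> X"
    then obtain g h where gh: "g \<in> A" "h \<in> B" "k = compose X g h" unfolding eq by blast
    moreover have "h x \<in> X" using gh E(4) x Bij_imp_funcset[of h X] by auto
    ultimately show "(x, k x) \<in> E' O E"
      using E(5)[of g "h x"] E(6)[of h x] x by (auto simp: compose_def)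
  qed
qed

lemma controlled_set_inv:
  assumes "controlled A"
  shows "controlled (set_inv\<^bsub>BijGroup X\<^esub> A)"
proof -
  from assms obtain E where E: "A \<subseteq> Bij X" "E \<in> \<E>" "\<And>g x. g \<in> A \<Longrightarrow> x \<in> X \<Longrightarrow> (x, g x) \<in> E"
    by (meson controlledE)
  have eq: "set_inv\<^bsub>BijGroup X\<^esub> A = {restrict (inv_into X g) X | g. g \<in> A}"
    using E(1) by (force simp: SET_INV_def inv_BijGroup)
  \<comment> \<open>Since \<open>g\<close> moves the preimage of \<open>x\<close> to
    \<open>x\<close> along \<open>E\<close>, its inverse moves \<open>x\<close> along the
    converse.\<close>
  show ?thesis
  proof (rule controlledI[OF _ converse_closed[OF E(2)]])
    show "set_inv\<^bsub>BijGroup X\<^esub> A \<subseteq> Bij X"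
      using E(1) unfolding eq by (auto intro: restrict_inv_into_Bij)
    fix k x assume "k \<in> set_inv\<^bsub>BijGroup X\<^esub> A" and x: "x \<in> X"
    then obtain g where g: "g \<in> A" "k = restrict (inv_into X g) X" unfolding eq by blast
    then have "g \<in> Bij X" using E(1) by blast
    then have "inv_into X g x \<in> X" "g (inv_into X g x) = x"
      using x by (auto simp: Bij_def bij_betw_def inv_into_into f_inv_into_f)
    then show "(x, k x) \<in> E\<inverse>" using E(3)[OF g(1), of "inv_into X g x"] g(2) x by simp
  qed
qed

section \<open>The group of controlled permutations and its ideal\<close>

lemma perm_subgroup: "subgroup {g. controlled {g}} (BijGroup X)"
proof (rule group.subgroupI[OF group_BijGroup])
  show "{g. controlled {g}} \<subseteq> carrier (BijGroup X)"
    by (auto simp: controlled_def BijGroup_def)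
  obtain E where "E \<in> \<E>" using nonempty by blast
  then have "controlled {\<lambda>x\<in>X. x}"
    using diagonal by (intro controlledI[of _ E]) (auto simp: id_Bij)
  then show "{g. controlled {g}} \<noteq> {}" by blast
next
  fix g assume "g \<in> {g. controlled {g}}"
  then show "inv\<^bsub>BijGroup X\<^esub> g \<in> {g. controlled {g}}"
    using controlled_set_inv[of "{g}"] by (simp add: SET_INV_def)
next
  fix g h assume "g \<in> {g. controlled {g}}" "h \<in> {g. controlled {g}}"
  then show "g \<otimes>\<^bsub>BijGroup X\<^esub> h \<in> {g. controlled {g}}"
    using controlled_set_mult[of "{g}" "{h}"] by (simp add: set_mult_def)
qed

lemma controlled_imp_subset: "controlled A \<Longrightarrow> A \<subseteq> {g. controlled {g}}"
  using controlled_subset by blast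

text \<open>The transposition of \<open>x\<close> and \<open>y\<close> comes from a matching with a
  single edge, so it is controlled by \<open>E \<union> E\<inverse>\<close> for any entourage
  \<open>E\<close> containing \<open>(x, y)\<close>.\<close>

lemma perm_transitive: "transitive_action perm_group X (\<lambda>g. g)"
proof (intro transitive_action.intro group_action.intro transitive_action_axioms.intro)
  show "group_hom perm_group (BijGroup X) (\<lambda>g. g)"
    using group.canonical_inj_is_hom[OF group_BijGroup perm_subgroup]
    by (simp add: perm_group_def id_def)
  fix x y assume xy: "x \<in> X" "y \<in> X"
  let ?M = "{(x, y), (y, x)}"
  obtain E where E: "E \<in> \<E>" "(x, y) \<in> E" using pairs_covered xy by blast
  have M: "sym ?M" "single_valued ?M" "?M \<subseteq> X \<times> X"
    using xy by (auto simp: sym_def single_valued_def)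
  have "controlled {matching_perm X ?M}"
  proof (rule controlledI[OF _ entourage_Un[OF E(1) converse_closed[OF E(1)]]])
    show "{matching_perm X ?M} \<subseteq> Bij X" using matching_perm_Bij[OF M] by simp
    fix g z assume g: "g \<in> {matching_perm X ?M}" and z: "z \<in> X"
    show "(z, g z) \<in> E \<union> E\<inverse>"
    proof (cases "z \<in> Domain ?M")
      case True
      then obtain w where w: "(z, w) \<in> ?M" by blast
      then have "g z = w" using matching_perm_eq[OF M(2,3)] g by blast
      then show ?thesis using w E(2) by blast
    next
      case False
      then have "g z = z" using matching_perm_id[OF z] g by simp
      then show ?thesis using diagonal[OF E(1)] z by auto
    qed
  qed
  moreover have "matching_perm X ?M x = y" using matching_perm_eq[OF M(2,3), of x y] by simp
  ultimately show "\<exists>g\<in>carrier perm_group. g x = y" by (auto simp: perm_group_def)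
qed

lemma perm_group_ideal:
  assumes \<kappa>: "Cinfinite \<kappa>"
  shows "group_ideal perm_group (perm_ideal \<kappa>)"
  unfolding group_ideal_def subset_ideal_def
proof (intro conjI ballI allI impI)
  show "perm_ideal \<kappa> \<subseteq> Pow (carrier perm_group)"
    using controlled_imp_subset by (auto simp: perm_ideal_def perm_group_def)
next
  fix A B assume AB: "A \<in> perm_ideal \<kappa>" "B \<in> perm_ideal \<kappa>"
  then have AB': "controlled A" "controlled B" "|A| <o \<kappa>" "|B| <o \<kappa>"
    by (auto simp: perm_ideal_def)
  then show "A \<union> B \<in> perm_ideal \<kappa>"
    using controlled_Un card_of_Un_ordLess_infinite_Field[of \<kappa> A B] \<kappa>
    by (auto simp: perm_ideal_def cinfinite_def)
  \<comment> \<open>Inverses in the subgroup are those of the full permutation group, to which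
    \<open>controlled_set_inv\<close> applies.\<close>
  have inv: "set_inv\<^bsub>perm_group\<^esub> B = set_inv\<^bsub>BijGroup X\<^esub> B"
    using group.m_inv_consistent[OF group_BijGroup perm_subgroup] controlled_imp_subset[OF AB'(2)]
    by (force simp: SET_INV_def perm_group_def)
  have mult: "A <#>\<^bsub>perm_group\<^esub> C = A <#>\<^bsub>BijGroup X\<^esub> C" for C
    by (simp add: perm_group_def)
  have "set_inv\<^bsub>perm_group\<^esub> B = m_inv perm_group ` B" by (auto simp: SET_INV_def)
  then have "|set_inv\<^bsub>perm_group\<^esub> B| <o \<kappa>"
    using AB'(4) card_of_image ordLeq_ordLess_trans by metis
  then have "|A \<times> set_inv\<^bsub>perm_group\<^esub> B| <o \<kappa>"
    using card_of_Times_ordLess_Cinfinite AB'(3) \<kappa> by blast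
  moreover have "A <#>\<^bsub>perm_group\<^esub> (set_inv\<^bsub>perm_group\<^esub> B)
      = (\<lambda>(a, b). a \<otimes>\<^bsub>perm_group\<^esub> b) ` (A \<times> set_inv\<^bsub>perm_group\<^esub> B)"
    by (auto simp: set_mult_def)
  ultimately have "|A <#>\<^bsub>perm_group\<^esub> (set_inv\<^bsub>perm_group\<^esub> B)| <o \<kappa>"
    using card_of_image ordLeq_ordLess_trans by metis
  then show "A <#>\<^bsub>perm_group\<^esub> (set_inv\<^bsub>perm_group\<^esub> B) \<in> perm_ideal \<kappa>"
    using controlled_set_mult[OF AB'(1) controlled_set_inv[OF AB'(2)]]
    by (simp add: perm_ideal_def mult inv)
next
  fix A A' assume "A \<in> perm_ideal \<kappa>" "A' \<subseteq> A"
  then show "A' \<in> perm_ideal \<kappa>"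
    using controlled_subset card_of_mono1 ordLeq_ordLess_trans unfolding perm_ideal_def by blast
next
  fix F assume "finite F \<and> F \<subseteq> carrier perm_group"
  then show "F \<in> perm_ideal \<kappa>"
    using controlled_finite[of F] finite_card_of_ordLess_Cinfinite[OF _ \<kappa>]
    by (auto simp: perm_ideal_def perm_group_def)
qed

section \<open>Covering entourages by involutions\<close>

text \<open>Each pair of colours yields one involution, and there are fewer than
  \<open>\<kappa>\<close> such pairs. All the involutions move points only along \<open>E\<close>,
  so \<open>E\<close> controls them jointly.\<close>

lemma cover_of_colouring:
  fixes f :: "'a \<Rightarrow> 'c"
  assumes E: "E \<in> \<E>" "sym E" and \<kappa>: "Cinfinite \<kappa>" "|f ` X| <o \<kappa>"
    and f: "\<And>x y. (x, y) \<in> E O E \<Longrightarrow> x \<noteq> y \<Longrightarrow> f x \<noteq> f y"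
  shows "\<exists>A\<in>perm_ideal \<kappa>. \<forall>(x, y)\<in>E. \<exists>g\<in>A. g x = y"
proof -
  define M where "M a b = {(x, y) \<in> E. f x = a \<and> f y = b \<or> f x = b \<and> f y = a}" for a b
  have sym: "sym (M a b)" for a b
    using E(2) by (auto simp: M_def sym_def)
  have sub: "M a b \<subseteq> X \<times> X" for a b
    using subset_Times[OF E(1)] by (auto simp: M_def)
  have sv: "single_valued (M a b)" for a b
  proof (rule single_valuedI)
    fix x y z assume "(x, y) \<in> M a b" "(x, z) \<in> M a b"
    \<comment> \<open>The colour of \<open>x\<close> determines that of its partner, so
      \<open>y\<close> and \<open>z\<close> have equal colours while being related by
      \<open>E O E\<close> through \<open>x\<close>.\<close>
    then have "(y, x) \<in> E" "(x, z) \<in> E" "f y = f z"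
      using E(2) by (auto simp: M_def dest: symD)
    then show "y = z" using f[of y z] by blast
  qed
  let ?A = "(\<lambda>(a, b). matching_perm X (M a b)) ` (f ` X \<times> f ` X)"
  have "controlled ?A"
  proof (rule controlledI[OF _ E(1)])
    show "?A \<subseteq> Bij X" using matching_perm_Bij[OF sym sv sub] by auto
    fix g x assume "g \<in> ?A" and x: "x \<in> X"
    then obtain a b where g: "g = matching_perm X (M a b)" by auto
    show "(x, g x) \<in> E"
    proof (cases "x \<in> Domain (M a b)")
      case True
      then obtain y where "(x, y) \<in> M a b" by blast
      then show ?thesis using matching_perm_eq[OF sv sub] g by (auto simp: M_def)
    next
      case False
      then show ?thesis using matching_perm_id[OF x] g diagonal[OF E(1)] x by auto
    qed
  qed
  moreover have "|?A| <o \<kappa>"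
    using card_of_image card_of_Times_ordLess_Cinfinite[OF \<kappa>(2,2,1)] by (rule ordLeq_ordLess_trans)
  ultimately have "?A \<in> perm_ideal \<kappa>" by (simp add: perm_ideal_def)
  moreover have "\<exists>g\<in>?A. g x = y" if "(x, y) \<in> E" for x y
  proof -
    have "matching_perm X (M (f x) (f y)) x = y"
      using that by (intro matching_perm_eq[OF sv sub]) (simp add: M_def)
    moreover have "(f x, f y) \<in> f ` X \<times> f ` X" using subset_Times[OF E(1)] that by blast
    then have "matching_perm X (M (f x) (f y)) \<in> ?A" by (rule image_eqI[rotated]) simp
    ultimately show ?thesis by (rule bexI)
  qed
  ultimately show ?thesis by (intro bexI[of _ ?A]) auto
qed

text \<open>\<open>E\<close> is symmetrised to \<open>D\<close>, and the cardinality hypothesis is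
  applied to \<open>D O D\<close>, the relation to be coloured properly. Its supremum
  \<open>r\<close> bounds the degrees and decides between the two colouring lemmas.\<close>

lemma entourage_cover:
  assumes \<kappa>: "Cinfinite \<kappa>" and lt: "\<And>E. E \<in> \<E> \<Longrightarrow> card_Sup X (\<lambda>x. E `` {x}) <o \<kappa>"
    and E: "E \<in> \<E>"
  shows "\<exists>A\<in>perm_ideal \<kappa>. \<forall>(x, y)\<in>E. \<exists>g\<in>A. g x = y"
proof -
  define D where "D = E \<union> E\<inverse>"
  have D: "D \<in> \<E>" "sym D"
    unfolding D_def using entourage_Un[OF E converse_closed[OF E]] by (auto simp: sym_def)
  have F: "D O D \<in> \<E>" "sym (D O D)"
    using relcomp_closed[OF D(1) D(1)] D(2) by (auto simp: sym_def)
  obtain r where r_def: "r = card_Sup X (\<lambda>x. (D O D) `` {x})" by simp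
  have r: "Card_order r" "\<And>x. x \<in> X \<Longrightarrow> |(D O D) `` {x}| \<le>o r" "r <o \<kappa>"
    using is_card_Sup_card_Sup[of X "\<lambda>x. (D O D) `` {x}"] lt[OF F(1)]
    by (auto simp: is_card_Sup_def r_def)
  have r_Field: "|Field r| =o r" using r(1) by (rule card_of_Field_ordIso)
  have "\<exists>A\<in>perm_ideal \<kappa>. \<forall>(x, y)\<in>D. \<exists>g\<in>A. g x = y"
  proof (cases "finite (Field r)")
    case True
    \<comment> \<open>At most \<open>card (Field r)\<close> neighbours, so one colour more than that
      suffices.\<close>
    have deg: "finite {y \<in> X. (x, y) \<in> D O D \<and> x \<noteq> y} \<and>
        card {y \<in> X. (x, y) \<in> D O D \<and> x \<noteq> y} < Suc (card (Field r))" (is "finite ?N \<and> _")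
      if x: "x \<in> X" for x
    proof -
      have "|?N| \<le>o |(D O D) `` {x}|" by (rule card_of_mono1) auto
      also have "|(D O D) `` {x}| \<le>o r" using r(2)[OF x] .
      also have "r =o |Field r|" using r_Field by (rule ordIso_symmetric)
      finally have "|?N| \<le>o |Field r|" .
      then obtain h where "inj_on h ?N" "h ` ?N \<subseteq> Field r"
        unfolding card_of_ordLeq[symmetric] by blast
      then show ?thesis
        using True card_inj_on_le[of h ?N "Field r"] inj_on_finite[of h ?N "Field r"]
        by (simp only: less_Suc_eq_le simp_thms)
    qed
    have "\<exists>f. f ` X \<subseteq> {..<Suc (card (Field r))} \<and>
        (\<forall>x\<in>X. \<forall>y\<in>X. (x, y) \<in> D O D \<longrightarrow> x \<noteq> y \<longrightarrow> f x \<noteq> f y)"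
      by (rule finite_degree_colouring[OF F(2)]) (rule deg)
    then obtain f where f: "f ` X \<subseteq> {..<Suc (card (Field r))}"
      "\<forall>x\<in>X. \<forall>y\<in>X. (x, y) \<in> D O D \<longrightarrow> x \<noteq> y \<longrightarrow> f x \<noteq> f y"
      by (elim exE conjE)
    have "finite (f ` X)" using f(1) finite_subset by blast
    then have "|f ` X| <o \<kappa>" using finite_card_of_ordLess_Cinfinite \<kappa> by blast
    then show ?thesis
      using f(2) subset_Times[OF F(1)] by (intro cover_of_colouring[OF D \<kappa>, of f]) blast+
  next
    case False
    then have inf: "Cinfinite r" using r(1) by (simp add: cinfinite_def)
    \<comment> \<open>The colouring lemma speaks of the whole type; points outside \<open>X\<close>
      have no neighbours.\<close>
    have "|(D O D) `` {x}| \<le>o r" for x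
    proof (cases "x \<in> X")
      case False
      then have "(D O D) `` {x} = {}" using subset_Times[OF F(1)] by blast
      then show ?thesis
        using finite_card_of_ordLess_Cinfinite[OF _ inf, of "{} :: 'a set"] by (simp add: ordLess_imp_ordLeq)
    qed (rule r(2))
    then obtain f where f: "range f \<subseteq> Field r"
      "\<And>x y. (x, y) \<in> D O D \<Longrightarrow> x \<noteq> y \<Longrightarrow> f x \<noteq> f y"
      using infinite_degree_colouring[OF F(2) _ inf] by blast
    \<comment> \<open>The supremum itself lies strictly below \<open>\<kappa>\<close>, hence so does
      the number of colours.\<close>
    have "|f ` X| \<le>o |Field r|" using f(1) by (intro card_of_mono1) auto
    also have "|Field r| =o r" by (rule r_Field)
    also note r(3)
    finally have "|f ` X| <o \<kappa>" .
    then show ?thesis using f(2) by (intro cover_of_colouring[OF D \<kappa>, of f]) auto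
  qed
  then obtain A where "A \<in> perm_ideal \<kappa>" "\<forall>(x, y)\<in>D. \<exists>g\<in>A. g x = y" by blast
  then show ?thesis by (intro bexI[of _ A]) (auto simp: D_def)
qed

text \<open>A set of the action base is an entourage because its permutations share one, and it
  contains the diagonal because the identity is among them. That these sets are cofinal is
  \<open>entourage_cover\<close>.\<close>

lemma coarse_base_perm:
  assumes \<kappa>: "Cinfinite \<kappa>" and lt: "\<And>E. E \<in> \<E> \<Longrightarrow> card_Sup X (\<lambda>x. E `` {x}) <o \<kappa>"
  shows "coarse_base \<E> (action_base perm_group X (\<lambda>g. g) (perm_ideal \<kappa>))"
proof -
  let ?R = "\<lambda>A. {(x, y). x \<in> X \<and> y \<in> X \<and> y \<in> (\<lambda>a. a x) ` A}"
  have one: "\<one>\<^bsub>perm_group\<^esub> = (\<lambda>x\<in>X. x)" by (simp add: perm_group_def BijGroup_def)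
  have "{\<one>\<^bsub>perm_group\<^esub>} \<subseteq> carrier perm_group"
    using subgroup.one_closed[OF perm_subgroup] by (simp add: perm_group_def)
  then have one_ideal: "{\<one>\<^bsub>perm_group\<^esub>} \<in> perm_ideal \<kappa>"
    using perm_group_ideal[OF \<kappa>] unfolding group_ideal_def by blast
  have "?R A \<in> \<E>" if A: "A \<in> perm_ideal \<kappa>" "\<one>\<^bsub>perm_group\<^esub> \<in> A" for A
  proof -
    have "controlled A" using A(1) by (simp add: perm_ideal_def)
    then obtain E where E: "E \<in> \<E>" "\<And>g x. g \<in> A \<Longrightarrow> x \<in> X \<Longrightarrow> (x, g x) \<in> E"
      by (meson controlledE)
    show ?thesis
      using A(2) E(2) one by (intro subset_closed[OF E(1)]) (auto intro!: image_eqI[of _ _ "\<lambda>x\<in>X. x"])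
  qed
  moreover have "\<exists>A. A \<in> perm_ideal \<kappa> \<and> \<one>\<^bsub>perm_group\<^esub> \<in> A \<and> E \<subseteq> ?R A" if E: "E \<in> \<E>" for E
  proof -
    obtain A where A: "A \<in> perm_ideal \<kappa>" "\<forall>(x, y)\<in>E. \<exists>g\<in>A. g x = y"
      using entourage_cover[OF \<kappa> lt E] by blast
    \<comment> \<open>The action base admits only sets containing the identity, so it is adjoined to
      the cover.\<close>
    have "A \<union> {\<one>\<^bsub>perm_group\<^esub>} \<in> perm_ideal \<kappa>"
      using perm_group_ideal[OF \<kappa>] A(1) one_ideal unfolding group_ideal_def subset_ideal_def by blast
    moreover have "E \<subseteq> ?R (A \<union> {\<one>\<^bsub>perm_group\<^esub>})"
      using A(2) subset_Times[OF E] by fastforce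
    ultimately show ?thesis by blast
  qed
  moreover have "action_base perm_group X (\<lambda>g. g) (perm_ideal \<kappa>)
      = ?R ` {A \<in> perm_ideal \<kappa>. \<one>\<^bsub>perm_group\<^esub> \<in> A}"
    unfolding action_base_def by (rule setcompr_eq_image)
  ultimately show ?thesis
    unfolding coarse_base_def by (simp add: image_subset_iff)
qed

end

section \<open>The identity as an asymorphism\<close>

lemma ballean_asymorphic_refl:
  assumes "ballean X \<E>"
  shows "asymorphic X \<E> X \<E>"
proof -
  have sub: "E \<subseteq> X \<times> X" if "E \<in> \<E>" for E using ballean.subset_Times[OF assms that] .
  have id: "inv_into X (\<lambda>x. x) x = x" if "x \<in> X" for x
    using inv_into_f_f[of "\<lambda>x. x" X x] that by simp
  \<comment> \<open>Stated for every \<open>f\<close> that is the identity on \<open>X\<close>,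
    since \<open>inv_into\<close> is known to invert only there.\<close>
  have "macro_uniform X \<E> X \<E> f" if f: "\<And>x. x \<in> X \<Longrightarrow> f x = x" for f
    unfolding macro_uniform_def
  proof (intro conjI ballI bexI)
    show "f \<in> X \<rightarrow> X" using f by auto
    fix E x assume "E \<in> \<E>" "x \<in> X"
    then show "f ` (E `` {x}) \<subseteq> E `` {f x}" using f sub[of E] by fastforce
  qed
  from this[of "\<lambda>x. x"] this[of "inv_into X (\<lambda>x. x)"] id
  have "asymorphism X \<E> X \<E> (\<lambda>x. x)"
    unfolding asymorphism_def by (simp add: bij_betw_def)
  then show ?thesis unfolding asymorphic_def by blast
qed

theorem theorem2:
  fixes X :: "'a set" and \<E> :: "('a \<times> 'a) set set" and \<kappa> :: "'k rel"
  assumes "ballean X \<E>"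
    and "Cinfinite \<kappa>"
    and "\<And>E. E \<in> \<E> \<Longrightarrow> card_Sup X (\<lambda>x. E `` {x}) <o \<kappa>"
  shows "\<exists>(G :: ('a \<Rightarrow> 'a) monoid) \<I>.
           (\<exists>H. subgroup H (BijGroup X) \<and> G = (BijGroup X)\<lparr>carrier := H\<rparr>) \<and>
           transitive_action G X (\<lambda>g. g) \<and>
           group_ideal G \<I> \<and>
           asymorphic X \<E> X (action_coarse G X (\<lambda>g. g) \<I>) \<and>
           (\<forall>A\<in>\<I>. |A| <o \<kappa>)"
proof -
  interpret ballean X \<E> by fact
  note ideal = perm_group_ideal[OF assms(2)]
  \<comment> \<open>Both coarse structures have the same base, so they are equal and not merely
    asymorphic.\<close>
  have "action_coarse perm_group X (\<lambda>g. g) (perm_ideal \<kappa>) = \<E>"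
    by (rule coarse_base_unique[OF action_coarse_structure[OF perm_transitive ideal] assms(1)
        coarse_base_perm[OF assms(2,3)]])
  then have "asymorphic X \<E> X (action_coarse perm_group X (\<lambda>g. g) (perm_ideal \<kappa>))"
    using ballean_asymorphic_refl[OF assms(1)] by simp
  moreover have "\<exists>H. subgroup H (BijGroup X) \<and> perm_group = (BijGroup X)\<lparr>carrier := H\<rparr>"
    by (intro exI conjI, rule perm_subgroup, rule perm_group_def)
  moreover have "\<forall>A\<in>perm_ideal \<kappa>. |A| <o \<kappa>" by (simp add: perm_ideal_def)
  ultimately show ?thesis
    using perm_transitive ideal by (intro exI[of _ perm_group] exI[of _ "perm_ideal \<kappa>"] conjI)
qed

end
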